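(* Fix $t$, $\delta\in(0,1)$ and $\Lambda>2$. Let $(\hat\lambda,\hat b_{t+1})\in\arg\min_{\lambda\in(2,\Lambda),\,b\in H}\hat J_t(\lambda,b)$, let $\hat B_{t+1}(x_{t+1}):=\hat b_{t+1}(x_{t+1})+\hat\tau_{\hat\lambda,\hat b_{t+1}}+\epsilon_0$, and assume $\hat B_{t+1}$ has worst-case coverage at level $c\in(0,1)$, i.e. $\Pr_{x_t\sim p^{\mathrm{pre}}_t(\cdot\mid x_{t+1})}[\hat v_t(x_t)\ge \hat B_{t+1}(x_{t+1})]\le c$ for all $x_{t+1}$. Suppose there is a constant $\sigma_t^2>0$ such that, for each $x_{t+1}$, $\hat v_t(x_t)$ is $\sigma_t^2$-sub-Gaussian under $p^{\mathrm{pre}}_t(x_t\mid x_{t+1})$. Assume further that $\delta\le e^{-4\sigma_t^2}$, that $\Lambda\ge\sqrt{\log(1/\delta)/\sigma_t^2}$, and that the function $x_{t+1}\mapsto\mathbb E_{x_t\sim p^{\mathrm{pre}}_t(\cdot\mid x_{t+1})}[\hat v_t(x_t)]$ belongs to $H$. Then, on the good training event $\mathcal G_t$, the kernel $\hat q_t(\cdot\mid x_{t+1})$ induced by rejection sampling with baseline $\hat B_{t+1}$ satisfies $$\mathbb E_{x_{t+1}\sim\hat q_{t+1}}\left[d_{TV}\left(\hat q_t(\cdot\mid x_{t+1}),\hat p_t(\cdot\mid x_{t+1})\right)\right]\le\frac{2\delta}{(1-c)^2}\,e^{2\sigma_t\sqrt{\log\frac1\delta}+2\epsilon_0}.$$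
   Context: A random variable $X$ is $\sigma^2$-sub-Gaussian if $\mathbb E[e^{\lambda(X-\mathbb EX)}]\le e^{\lambda^2\sigma^2/2}$ for all $\lambda\in\mathbb R$. $\mathcal X$ is a (continuous or discrete) state space; the pretrained Markov process has initial law $p^{\mathrm{pre}}_T$ and kernels $p^{\mathrm{pre}}_t(x_t\mid x_{t+1})$, $t=0,\dots,T-1$. $\hat v_t:\mathcal X\to[-B,B]$ are given estimates of soft-value functions, and $\hat p_t(x_t\mid x_{t+1})\propto e^{\hat v_t(x_t)}p^{\mathrm{pre}}_t(x_t\mid x_{t+1})$. Sampling with baselines: given a baseline function $B_{t+1}:\mathcal X\to\mathbb R$, $\hat q_t(\cdot\mid x_{t+1})$ is the law of the first accepted proposal when i.i.d. proposals $x_t\sim p^{\mathrm{pre}}_t(\cdot\mid x_{t+1})$ are each accepted with probability $\min\{1,e^{\hat v_t(x_t)-B_{t+1}(x_{t+1})}\}$. $\hat q_{t+1}$ denotes the marginal law of $x_{t+1}$ produced by this sampler at the earlier steps $T,\dots,t+1$ (started by accepting proposals from $p^{\mathrm{pre}}_T$ with probability $\min\{1,e^{\hat v_T(x_T)-B_{T+1}}\}$ for a constant $B_{T+1}$). Let $H$ be a class of functions $\mathcal X\to[-B,B]$. With $\mathbb E$ the expectation over $x_{t+1}\sim\hat q_{t+1}$, $x_t\sim p^{\mathrm{pre}}_t(\cdot\mid x_{t+1})$, define $$J_t(\lambda,b)=\tfrac1\lambda\log\mathbb E[e^{\lambda(\hat v_t(x_t)-b(x_{t+1}))}]+\tfrac1\lambda\log\mathbb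 E[e^{\lambda(b(x_{t+1})-\hat v_t(x_t))}]+\tfrac2\lambda\log\tfrac1\delta,$$ $$\tau_{\lambda,b}=\tfrac1\lambda\left(\log\tfrac1\delta+\log\mathbb E[e^{\lambda(\hat v_t(x_t)-b(x_{t+1}))}]\right).$$ $\hat J_t$ and $\hat\tau_{\lambda,b}$ are obtained by replacing $\mathbb E$ by the empirical average $\hat{\mathbb E}$ over $m$ i.i.d. samples $(x^i_{t+1},x^i_t)$ from this joint law. $J_t^*$ is the minimum of $J_t$ over $(2,\Lambda)\times H$ (assumed attained). For $\eta\in(0,1)$, $\epsilon_0:=e^{4B\Lambda}\left(2\hat{\mathcal R}_m(H)+\sqrt{\log(1/\eta)/(2m)}\right)$, where $\hat{\mathcal R}_m(H)=\mathbb E_\sigma[\sup_{b\in H}\frac1m\sum_i\sigma_i b(x^i_{t+1})]$ ($\sigma_i$ i.i.d. Rademacher) is the empirical Rademacher complexity. The good training event $\mathcal G_t$ is the event (over the $m$ training samples) that $J_t(\hat\lambda,\hat b_{t+1})-J^*_t\le2\epsilon_0$ and $|\hat\tau_{\hat\lambda,\hat b_{t+1}}-\tau_{\hat\lambda,\hat b_{t+1}}|\le\epsilon_0$. $d_{TV}$ is total variation distance. *)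

theory Defs
  imports "HOL-Probability.Probability"
begin

text \<open>Integrability is required because a Bochner integral is 0 when the integrand is not
  integrable, so the inequality alone would not express a finite moment generating function.\<close>

definition sub_gaussian :: "'a measure \<Rightarrow> ('a \<Rightarrow> real) \<Rightarrow> real \<Rightarrow> bool" where
  "sub_gaussian M X s2 \<longleftrightarrow>
     integrable M X \<and>
     (\<forall>l. integrable M (\<lambda>x. exp (l * (X x - (\<integral>z. X z \<partial>M)))) \<and>
          (\<integral>x. exp (l * (X x - (\<integral>z. X z \<partial>M))) \<partial>M) \<le> exp (l\<^sup>2 * s2 / 2))"

definition tv_dist :: "'a measure \<Rightarrow> 'a measure \<Rightarrow> real" where
  "tv_dist M N = (SUP A\<in>sets M. \<bar>measure M A - measure N A\<bar>)"

definition tilted_law :: "'a measure \<Rightarrow> ('a \<Rightarrow> real) \<Rightarrow> 'a measure" where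
  "tilted_law M v = density M (\<lambda>y. ennreal (exp (v y) / (\<integral>z. exp (v z) \<partial>M)))"

text \<open>The first component of trial \<open>n\<close> is a proposal from \<open>M\<close>; the second is an independent
  uniform variable on \<open>[0,1]\<close>, and the proposal is accepted when that variable is at most
  \<open>a\<close> of the proposal, an event of conditional probability \<open>a\<close> of the proposal. If no trial is
  ever accepted (a null event whenever the acceptance probability is positive), \<open>LEAST\<close> is an
  unspecified index.\<close>

definition first_accepted_law :: "'a measure \<Rightarrow> ('a \<Rightarrow> real) \<Rightarrow> 'a measure" where
  "first_accepted_law M a =
     distr (\<Pi>\<^sub>M n\<in>(UNIV :: nat set). M \<Otimes>\<^sub>M uniform_measure lborel {0..1::real}) M
       (\<lambda>w. fst (w (LEAST n. snd (w n) \<le> a (fst (w n)))))"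

definition baseline_law :: "'a measure \<Rightarrow> ('a \<Rightarrow> real) \<Rightarrow> real \<Rightarrow> 'a measure" where
  "baseline_law M v \<beta> = first_accepted_law M (\<lambda>y. min 1 (exp (v y - \<beta>)))"

text \<open>The sampler runs backwards in time: \<open>sampler_after \<dots> n\<close> is the law of its state at time
  \<open>T - n\<close>. The kernel \<open>p s\<close> goes from time \<open>Suc s\<close> to time \<open>s\<close>, and \<open>Bs (Suc s)\<close> is the baseline
  used in that step, as a function of the state at time \<open>Suc s\<close>. The constant \<open>Binit\<close> is the
  baseline for the draw at time \<open>T\<close>.\<close>

primrec sampler_after ::
  "nat \<Rightarrow> 'a measure \<Rightarrow> (nat \<Rightarrow> 'a \<Rightarrow> 'a measure) \<Rightarrow> (nat \<Rightarrow> 'a \<Rightarrow> real) \<Rightarrow> real \<Rightarrow>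
   (nat \<Rightarrow> 'a \<Rightarrow> real) \<Rightarrow> nat \<Rightarrow> 'a measure" where
  "sampler_after T pT p v Binit Bs 0 = baseline_law pT (v T) Binit"
| "sampler_after T pT p v Binit Bs (Suc n) =
     sampler_after T pT p v Binit Bs n \<bind>
       (\<lambda>x. baseline_law (p (T - Suc n) x) (v (T - Suc n)) (Bs (T - n) x))"

definition sampler_marginal ::
  "nat \<Rightarrow> 'a measure \<Rightarrow> (nat \<Rightarrow> 'a \<Rightarrow> 'a measure) \<Rightarrow> (nat \<Rightarrow> 'a \<Rightarrow> real) \<Rightarrow> real \<Rightarrow>
   (nat \<Rightarrow> 'a \<Rightarrow> real) \<Rightarrow> nat \<Rightarrow> 'a measure" where
  "sampler_marginal T pT p v Binit Bs s = sampler_after T pT p v Binit Bs (T - s)"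

definition joint_law :: "'a measure \<Rightarrow> 'a measure \<Rightarrow> ('a \<Rightarrow> 'a measure) \<Rightarrow> ('a \<times> 'a) measure" where
  "joint_law S q K = q \<bind> (\<lambda>x. K x \<bind> (\<lambda>y. return (S \<Otimes>\<^sub>M S) (x, y)))"

text \<open>\<open>J_fun\<close> and \<open>tau_fun\<close> take the expectation operator as an argument, so that the population
  and the empirical versions (with \<open>empirical_mean\<close>) differ only in this operator. Pairs are ordered as
  \<open>(x\<^sub>t\<^sub>+\<^sub>1, x\<^sub>t)\<close>.\<close>

definition empirical_mean :: "nat \<Rightarrow> (nat \<Rightarrow> 'b) \<Rightarrow> ('b \<Rightarrow> real) \<Rightarrow> real" where
  "empirical_mean m z f = (\<Sum>i<m. f (z i)) / real m"

definition J_fun ::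
  "((('a \<times> 'a) \<Rightarrow> real) \<Rightarrow> real) \<Rightarrow> ('a \<Rightarrow> real) \<Rightarrow> real \<Rightarrow> real \<Rightarrow> ('a \<Rightarrow> real) \<Rightarrow> real" where
  "J_fun E v \<delta> l b =
     1 / l * ln (E (\<lambda>(x, y). exp (l * (v y - b x)))) +
     1 / l * ln (E (\<lambda>(x, y). exp (l * (b x - v y)))) +
     2 / l * ln (1 / \<delta>)"

definition tau_fun ::
  "((('a \<times> 'a) \<Rightarrow> real) \<Rightarrow> real) \<Rightarrow> ('a \<Rightarrow> real) \<Rightarrow> real \<Rightarrow> real \<Rightarrow> ('a \<Rightarrow> real) \<Rightarrow> real" where
  "tau_fun E v \<delta> l b =
     1 / l * (ln (1 / \<delta>) + ln (E (\<lambda>(x, y). exp (l * (v y - b x)))))"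

definition emp_rademacher :: "nat \<Rightarrow> ('a \<Rightarrow> real) set \<Rightarrow> (nat \<Rightarrow> 'a) \<Rightarrow> real" where
  "emp_rademacher m H xs =
     measure_pmf.expectation (Pi_pmf {..<m} 0 (\<lambda>_. pmf_of_set {-1, 1 :: real}))
       (\<lambda>s. SUP b\<in>H. (1 / real m) * (\<Sum>i<m. s i * b (xs i)))"

definition eps0 :: "real \<Rightarrow> real \<Rightarrow> real \<Rightarrow> nat \<Rightarrow> ('a \<Rightarrow> real) set \<Rightarrow> (nat \<Rightarrow> 'a) \<Rightarrow> real" where
  "eps0 B \<Lambda> \<eta> m H xs =
     exp (4 * B * \<Lambda>) * (2 * emp_rademacher m H xs + sqrt (ln (1 / \<eta>) / (2 * real m)))"

end

theory Submission
  imports Defs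
begin

text \<open>Fix \<open>x\<close> and write \<open>\<mu>\<close> for the conditional mean of \<open>v\<close>, \<open>\<beta>\<close> for the baseline and \<open>L\<^sup>2 = ln (1 / \<delta>)\<close>.
  For every \<open>k \<ge> 1\<close> the total variation distance is at most \<open>exp (\<beta> - \<mu>) * \<integral>exp (k * (v - \<beta>))\<close>.
  If \<open>\<beta> - \<mu> \<le> 2 * \<sigma> * L\<close>, take for \<open>k\<close> the trained \<open>\<lambda>\<close>: on the good event \<open>\<beta> \<ge> b + \<tau>\<close>, and by the
  choice of \<open>\<tau>\<close> the mean of \<open>exp (\<lambda> * (v - b - \<tau>))\<close> over the joint law is exactly \<open>\<delta>\<close>. If
  \<open>\<beta> - \<mu> > 2 * \<sigma> * L\<close>, take \<open>k = 2 * L / \<sigma>\<close>: the sub-Gaussian bound gives \<open>\<delta>\<^sup>2 * exp (2 * \<sigma> * L)\<close>.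
  Together the mean distance is at most \<open>(\<delta> + \<delta>\<^sup>2) * exp (2 * \<sigma> * L)\<close>.\<close>

section \<open>Law of the first accepted proposal\<close>

text \<open>The trials with first acceptance at time \<open>n\<close> bound the law from below by the claimed value, on
  \<open>A\<close> and on its complement. Both bounds are sharp because they add up to 1, so the null event
  without any acceptance needs no separate treatment.\<close>

lemma measure_first_accepted_law:
  fixes M :: "'a measure" and a :: "'a \<Rightarrow> real"
  defines "F \<equiv> first_accepted_law M a"
  assumes M: "prob_space M"
    and a [measurable]: "a \<in> borel_measurable M"
    and a01: "\<And>x. x \<in> space M \<Longrightarrow> 0 \<le> a x \<and> a x \<le> 1"
    and pos: "0 < (\<integral>x. a x \<partial>M)"
  shows "prob_space F"
    and "A \<in> sets M \<Longrightarrow> measure F A = (\<integral>x. a x * indicator A x \<partial>M) / (\<integral>x. a x \<partial>M)"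
proof -
  define U where "U = uniform_measure lborel {0..1::real}"
  define N where "N = M \<Otimes>\<^sub>M U"
  define W where "W = (\<Pi>\<^sub>M n\<in>(UNIV :: nat set). N)"
  define X where "X = (\<lambda>w::nat \<Rightarrow> 'a \<times> real. fst (w (LEAST n. snd (w n) \<le> a (fst (w n)))))"
  interpret M: prob_space M by fact
  interpret U: prob_space U unfolding U_def by (rule prob_space_uniform_measure) auto
  interpret MU: pair_prob_space M U ..
  interpret N: prob_space N unfolding N_def by unfold_locales
  interpret W: product_prob_space "\<lambda>_. N" "UNIV :: nat set" by unfold_locales
  interpret Wp: prob_space W unfolding W_def by (rule W.P.prob_space_axioms)
  have sets_U [measurable_cong]: "sets U = sets borel" by (simp add: U_def)
  have space_U [simp]: "space U = UNIV" by (simp add: U_def)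
  have meas_fst [measurable]: "fst \<in> N \<rightarrow>\<^sub>M M" and meas_snd [measurable]: "snd \<in> N \<rightarrow>\<^sub>M borel"
    unfolding N_def by measurable
  have comp [measurable]: "(\<lambda>w. w n) \<in> W \<rightarrow>\<^sub>M N" for n
    unfolding W_def by measurable
  have X [measurable]: "X \<in> W \<rightarrow>\<^sub>M M"
  proof -
    \<comment> \<open>\<open>X\<close> evaluates one of countably many measurable maps at a
      measurable random index, which keeps it measurable.\<close>
    have "(\<lambda>w. (\<lambda>n w. fst (w n)) (LEAST n. snd (w n) \<le> a (fst (w n))) w) \<in> W \<rightarrow>\<^sub>M M"
      by (rule measurable_compose_countable) measurable
    then show ?thesis by (simp add: X_def)
  qed
  have F: "F = distr W M X"
    by (simp add: F_def first_accepted_law_def W_def N_def U_def X_def)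
  show F_prob: "prob_space F" unfolding F by (rule Wp.prob_space_distr) measurable
  interpret F: prob_space F by fact
  have sets_F [simp]: "sets F = sets M" by (simp add: F)
  have space_F [simp]: "space F = space M" by (simp add: F)

  define h where "h A = (\<integral>x. a x * indicator A x \<partial>M)" for A
  define r where "r = (\<integral>x. a x \<partial>M)"
  define hit where "hit A = {z \<in> space N. fst z \<in> A \<and> snd z \<le> a (fst z)}" for A
  define miss where "miss = {z \<in> space N. \<not> snd z \<le> a (fst z)}"
  have int_a: "integrable M (\<lambda>x. a x * indicator A x)" if [measurable]: "A \<in> sets M" for A
    using a01 by (intro M.integrable_const_bound[of _ 1]) (auto split: split_indicator)
  have int_a': "integrable M a"
    using a01 by (intro M.integrable_const_bound[of _ 1]) auto
  have hit_sets [measurable]: "hit A \<in> sets N" if [measurable]: "A \<in> sets M" for A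
    unfolding hit_def by measurable
  have miss_sets [measurable]: "miss \<in> sets N" unfolding miss_def by measurable
  have hit: "measure N (hit A) = h A" if A [measurable]: "A \<in> sets M" for A
  proof -
    have "emeasure N (hit A) = (\<integral>\<^sup>+x. emeasure U (Pair x -` hit A) \<partial>M)"
      unfolding N_def by (rule U.emeasure_pair_measure_alt[OF hit_sets[OF A, unfolded N_def]])
    also have "\<dots> = (\<integral>\<^sup>+x. ennreal (a x * indicator A x) \<partial>M)"
    proof (rule nn_integral_cong)
      fix x assume x: "x \<in> space M"
      show "emeasure U (Pair x -` hit A) = ennreal (a x * indicator A x)"
      proof (cases "x \<in> A")
        case True
        \<comment> \<open>For a fixed proposal in \<open>A\<close>, the accepting values of the
          uniform variable form a half-line, since \<open>U\<close> lives on all reals. Its mass is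
          exactly \<open>a x\<close> because \<open>a x\<close> lies between 0 and 1.\<close>
        then have "Pair x -` hit A = {..a x}"
          using x by (auto simp: hit_def N_def space_pair_measure)
        moreover have "{0..1} \<inter> {..a x} = {0..a x}" using a01[OF x] by auto
        ultimately show ?thesis using True a01[OF x] by (simp add: U_def divide_ennreal_def)
      next
        case False
        then have "Pair x -` hit A = {}" by (auto simp: hit_def)
        with False show ?thesis by simp
      qed
    qed
    also have "\<dots> = ennreal (h A)"
      unfolding h_def using a01
      by (intro nn_integral_eq_integral int_a A) (auto split: split_indicator)
    finally show ?thesis
      using a01 by (simp add: measure_def h_def integral_nonneg_AE split: split_indicator)
  qed
  have h_space: "h (space M) = r"
    unfolding h_def r_def by (rule Bochner_Integration.integral_cong) auto
  have miss: "measure N miss = 1 - r"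
  proof -
    have "miss = space N - hit (space M)"
      by (auto simp: miss_def hit_def N_def space_pair_measure)
    then show ?thesis
      using N.prob_compl[OF hit_sets[OF sets.top]] hit[OF sets.top] h_space by simp
  qed
  have r: "0 < r" "r \<le> 1"
    using pos a01 M.integral_le_const[OF int_a', of 1] by (auto simp: r_def)
  have h_nonneg: "0 \<le> h A" for A
    unfolding h_def using a01 by (auto intro!: integral_nonneg_AE split: split_indicator)

  have lower: "h A / r \<le> measure F A" if A [measurable]: "A \<in> sets M" for A
  proof -
    \<comment> \<open>\<open>Y\<close> prescribes rejection before trial \<open>n\<close> and an
      accepted proposal in \<open>A\<close> at trial \<open>n\<close>; \<open>E n\<close> is the
      resulting event. These events are disjoint, and their probabilities form a geometric series of
      ratio \<open>1 - r < 1\<close> with sum \<open>h A / r\<close>.\<close>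
    define Y where "Y n i = (if i < n then miss else hit A)" for n i :: nat
    have Y [measurable]: "Y n i \<in> sets N" for n i by (simp add: Y_def)
    define E where "E n = {w \<in> space W. \<forall>i\<in>{..n}. w i \<in> Y n i}" for n
    have E_sets [measurable]: "E n \<in> sets W" for n
      unfolding E_def by measurable
    have E: "measure W (E n) = h A * (1 - r) ^ n" for n
    proof -
      have "emeasure W (E n) = (\<Prod>i\<in>{..n}. emeasure N (Y n i))"
        unfolding E_def W_def by (rule W.emeasure_PiM_Collect) (auto simp: Y)
      also have "\<dots> = (\<Prod>i\<in>{..<n}. emeasure N (Y n i)) * emeasure N (hit A)"
        by (simp add: Y_def lessThan_Suc_atMost[symmetric])
      also have "\<dots> = (\<Prod>i\<in>{..<n}. emeasure N miss) * emeasure N (hit A)"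
        by (intro arg_cong2[of _ _ _ _ "(*)"] prod.cong) (auto simp: Y_def)
      also have "\<dots> = ennreal ((1 - r) ^ n * h A)"
        using r h_nonneg
        by (simp add: N.emeasure_eq_measure miss hit[OF A] ennreal_power[symmetric] ennreal_mult)
      finally show ?thesis
        using r h_nonneg by (simp add: measure_def mult.commute)
    qed
    have disj: "disjoint_family E"
    proof -
      \<comment> \<open>Membership in \<open>E i\<close> makes trial \<open>i\<close> accepted,
        while membership in \<open>E j\<close> with \<open>i < j\<close> makes it rejected.\<close>
      have "E i \<inter> E j = {}" if "i < j" for i j
      proof -
        have "w i \<in> miss \<and> w i \<in> hit A" if "w \<in> E i" "w \<in> E j" for w
          using that \<open>i < j\<close> by (auto simp: E_def Y_def dest: bspec[where x = i])
        then show ?thesis by (auto simp: miss_def hit_def)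
      qed
      then show ?thesis
        unfolding disjoint_family_on_def by (metis Int_commute linorder_neqE_nat)
    qed
    have sub: "(\<Union>n. E n) \<subseteq> X -` A \<inter> space W"
    proof
      fix w assume "w \<in> (\<Union>n. E n)"
      then obtain n where w: "w \<in> E n" by auto
      then have Yw: "w i \<in> Y n i" if "i \<le> n" for i using that by (simp add: E_def)
      from Yw[of n] have n: "w n \<in> hit A" by (simp add: Y_def)
      have less: "w i \<in> miss" if "i < n" for i using Yw[of i] that by (simp add: Y_def)
      have "(LEAST n. snd (w n) \<le> a (fst (w n))) = n"
        using n less by (intro Least_equality) (force simp: hit_def miss_def not_less[symmetric])+
      with n w show "w \<in> X -` A \<inter> space W" by (simp add: X_def hit_def E_def)
    qed
    have "(\<lambda>n. measure W (E n)) sums measure W (\<Union>n. E n)"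
      using disj by (intro Wp.finite_measure_UNION) auto
    moreover have "(\<lambda>n. h A * (1 - r) ^ n) sums (h A * (1 / (1 - (1 - r))))"
      using r by (intro sums_mult geometric_sums) auto
    ultimately have "measure W (\<Union>n. E n) = h A / r"
      by (simp add: E sums_unique2)
    moreover have "measure W (\<Union>n. E n) \<le> measure W (X -` A \<inter> space W)"
      by (rule Wp.finite_measure_mono[OF sub]) measurable
    ultimately show ?thesis by (simp add: F measure_distr)
  qed
  show "measure F A = (\<integral>x. a x * indicator A x \<partial>M) / (\<integral>x. a x \<partial>M)" if A: "A \<in> sets M"
  proof -
    have "h (space M - A) = r - h A"
      unfolding h_def r_def using A
      by (subst Bochner_Integration.integral_diff[symmetric])
         (auto intro!: int_a int_a' Bochner_Integration.integral_cong split: split_indicator)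
    moreover have "h (space M - A) / r \<le> 1 - measure F A"
      using lower[of "space M - A"] F.prob_compl[of A] A by auto
    ultimately have "measure F A \<le> h A / r"
      using r by (simp add: diff_divide_distrib)
    with lower[OF A] show ?thesis by (simp add: h_def r_def)
  qed
qed

section \<open>Exponential moments and normalising constants\<close>

lemma (in prob_space) integrable_exp_bounded:
  fixes w :: "'a \<Rightarrow> real"
  assumes [measurable]: "w \<in> borel_measurable M" and "\<And>x. x \<in> space M \<Longrightarrow> \<bar>w x\<bar> \<le> B"
  shows "integrable M (\<lambda>x. exp (k * (w x - \<beta>)))"
proof (rule integrable_const_bound[of _ "exp (\<bar>k\<bar> * (B + \<bar>\<beta>\<bar>))"])
  have "k * (w x - \<beta>) \<le> \<bar>k\<bar> * (B + \<bar>\<beta>\<bar>)" if "x \<in> space M" for x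
  proof -
    have "k * (w x - \<beta>) \<le> \<bar>k\<bar> * \<bar>w x - \<beta>\<bar>" by (metis abs_ge_self abs_mult)
    also have "\<dots> \<le> \<bar>k\<bar> * (B + \<bar>\<beta>\<bar>)"
      using assms(2)[OF that] by (intro mult_left_mono) auto
    finally show ?thesis .
  qed
  then show "AE x in M. norm (exp (k * (w x - \<beta>))) \<le> exp (\<bar>k\<bar> * (B + \<bar>\<beta>\<bar>))" by auto
qed measurable

text \<open>A nonnegative integrable function with integral 0 vanishes almost everywhere, which a
  strictly positive function on a probability space cannot do. Integrability excludes the default
  value 0 of the integral.\<close>

lemma (in prob_space) integral_exp_pos:
  fixes f :: "'a \<Rightarrow> real"
  assumes "integrable M (\<lambda>x. exp (f x))"
  shows "0 < (\<integral>x. exp (f x) \<partial>M)"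
proof -
  have "(\<integral>x. exp (f x) \<partial>M) \<noteq> 0"
    using assms by (subst integral_nonneg_eq_0_iff_AE) auto
  moreover have "0 \<le> (\<integral>x. exp (f x) \<partial>M)" by simp
  ultimately show ?thesis by linarith
qed

text \<open>The same argument with an integrand bounded by 1. Positivity lets the formula for the
  first accepted proposal apply to every baseline, however large.\<close>

lemma (in prob_space) acceptance_pos:
  fixes w :: "'a \<Rightarrow> real"
  assumes [measurable]: "w \<in> borel_measurable M"
  shows "0 < (\<integral>x. min 1 (exp (w x - \<beta>)) \<partial>M)"
proof -
  have "integrable M (\<lambda>x. min 1 (exp (w x - \<beta>)))"
    by (rule integrable_const_bound[of _ 1]) auto
  then have "(\<integral>x. min 1 (exp (w x - \<beta>)) \<partial>M) \<noteq> 0"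
    by (subst integral_nonneg_eq_0_iff_AE) (auto simp: min_def)
  moreover have "0 \<le> (\<integral>x. min 1 (exp (w x - \<beta>)) \<partial>M)" by simp
  ultimately show ?thesis by linarith
qed

lemma (in prob_space)
  fixes w :: "'a \<Rightarrow> real"
  assumes [measurable]: "w \<in> borel_measurable M"
  shows prob_space_baseline_law: "prob_space (baseline_law M w \<beta>)"
    and measure_baseline_law: "A \<in> sets M \<Longrightarrow> measure (baseline_law M w \<beta>) A =
      (\<integral>x. min 1 (exp (w x - \<beta>)) * indicator A x \<partial>M) / (\<integral>x. min 1 (exp (w x - \<beta>)) \<partial>M)"
  unfolding baseline_law_def
  using measure_first_accepted_law(1)[of M "\<lambda>x. min 1 (exp (w x - \<beta>))"]
    measure_first_accepted_law(2)[of M "\<lambda>x. min 1 (exp (w x - \<beta>))" A]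
    prob_space_axioms acceptance_pos[of w \<beta>] by auto

lemma sets_baseline_law [simp, measurable_cong]: "sets (baseline_law M w \<beta>) = sets M"
  by (simp add: baseline_law_def first_accepted_law_def)

lemma (in prob_space)
  fixes w :: "'a \<Rightarrow> real"
  assumes [measurable]: "w \<in> borel_measurable M" and int: "integrable M (\<lambda>x. exp (w x))"
  shows prob_space_tilted_law: "prob_space (tilted_law M w)"
    and measure_tilted_law: "A \<in> sets M \<Longrightarrow> measure (tilted_law M w) A =
      (\<integral>x. exp (w x) * indicator A x \<partial>M) / (\<integral>x. exp (w x) \<partial>M)"
proof -
  define Z where "Z = (\<integral>x. exp (w x) \<partial>M)"
  \<comment> \<open>By integrability \<open>Z\<close> is a genuine positive normaliser and not the
    default value 0, so the division below is meaningful.\<close>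
  have Z: "0 < Z" unfolding Z_def by (rule integral_exp_pos[OF int])
  have em: "emeasure (tilted_law M w) A = ennreal ((\<integral>x. exp (w x) * indicator A x \<partial>M) / Z)"
    if [measurable]: "A \<in> sets M" for A
  proof -
    have intA: "integrable M (\<lambda>x. exp (w x) * indicator A x)"
      by (rule integrable_real_mult_indicator[OF that int])
    have "emeasure (tilted_law M w) A = (\<integral>\<^sup>+x. ennreal (exp (w x) / Z) * indicator A x \<partial>M)"
      unfolding tilted_law_def Z_def[symmetric] by (rule emeasure_density) measurable
    also have "\<dots> = (\<integral>\<^sup>+x. ennreal (exp (w x) * indicator A x / Z) \<partial>M)"
      by (rule nn_integral_cong) (auto split: split_indicator)
    also have "\<dots> = ennreal (\<integral>x. exp (w x) * indicator A x / Z \<partial>M)"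
      using intA Z by (intro nn_integral_eq_integral) auto
    finally show ?thesis by simp
  qed
  show "measure (tilted_law M w) A =
      (\<integral>x. exp (w x) * indicator A x \<partial>M) / (\<integral>x. exp (w x) \<partial>M)" if "A \<in> sets M"
    using em[OF that] Z by (simp add: measure_def Z_def[symmetric])
  have "(\<integral>x. exp (w x) * indicator (space M) x \<partial>M) = Z"
    unfolding Z_def by (rule Bochner_Integration.integral_cong) auto
  with em[OF sets.top] Z show "prob_space (tilted_law M w)"
    by (intro prob_spaceI) (simp add: tilted_law_def)
qed

section \<open>Total variation distance between the baseline law and the tilted law\<close>

text \<open>With \<open>g = exp (w - \<beta>)\<close> and \<open>a = min 1 g\<close>, both laws have a density proportional to \<open>g\<close> or
  \<open>a\<close>, and \<open>g / \<integral>g - a / \<integral>a \<le> (g - a) / \<integral>g\<close> pointwise because \<open>\<integral>a \<le> \<integral>g\<close>.\<close>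

lemma (in prob_space) tv_dist_baseline_tilted:
  fixes w :: "'a \<Rightarrow> real"
  assumes w [measurable]: "w \<in> borel_measurable M" and int: "integrable M (\<lambda>x. exp (w x - \<beta>))"
  shows "tv_dist (baseline_law M w \<beta>) (tilted_law M w) \<le>
    (\<integral>x. exp (w x - \<beta>) - min 1 (exp (w x - \<beta>)) \<partial>M) / (\<integral>x. exp (w x - \<beta>) \<partial>M)"
proof -
  define g where "g x = exp (w x - \<beta>)" for x
  define a where "a x = min 1 (g x)" for x
  define G where "G = (\<integral>x. g x \<partial>M)"
  define R where "R = (\<integral>x. a x \<partial>M)"
  have [measurable]: "g \<in> borel_measurable M" "a \<in> borel_measurable M"
    unfolding a_def g_def by measurable
  have int_g: "integrable M g" using int by (simp add: g_def[abs_def])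
  have int_a: "integrable M a"
    by (rule integrable_const_bound[of _ 1]) (auto simp: a_def g_def)
  \<comment> \<open>Shifting the exponent by a constant multiplies numerator and normaliser of the
    tilted law by the same factor, so that law can be written with \<open>g\<close> as well.\<close>
  have exp_w: "exp (w x) = exp \<beta> * g x" for x by (simp add: g_def exp_diff)
  have int_w: "integrable M (\<lambda>x. exp (w x))" unfolding exp_w using int_g by simp
  interpret F: prob_space "baseline_law M w \<beta>" by (rule prob_space_baseline_law[OF w])
  interpret N: prob_space "tilted_law M w" by (rule prob_space_tilted_law[OF w int_w])
  have space_F [simp]: "space (baseline_law M w \<beta>) = space M"
    by (rule sets_eq_imp_space_eq) simp
  have sets_N [simp]: "sets (tilted_law M w) = sets M" and space_N [simp]: "space (tilted_law M w) = space M"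
    by (simp_all add: tilted_law_def)
  have R: "0 < R" using acceptance_pos[OF w, of \<beta>] by (simp add: R_def a_def g_def)
  have "R \<le> G" unfolding R_def G_def using int_a int_g by (intro integral_mono) (auto simp: a_def)
  with R have G: "0 < G" by simp
  have F: "measure (baseline_law M w \<beta>) A = (\<integral>x. a x * indicator A x \<partial>M) / R" if "A \<in> sets M" for A
    using measure_baseline_law[OF w that, of \<beta>] by (simp add: a_def g_def R_def)
  have N: "measure (tilted_law M w) A = (\<integral>x. g x * indicator A x \<partial>M) / G" if "A \<in> sets M" for A
    using measure_tilted_law[OF w int_w that] by (simp add: exp_w G_def mult.assoc)
  have one_sided: "measure (tilted_law M w) A - measure (baseline_law M w \<beta>) A \<le> (\<integral>x. g x - a x \<partial>M) / G"
    if A [measurable]: "A \<in> sets M" for A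
  proof -
    have int_gA: "integrable M (\<lambda>x. g x * indicator A x)" and int_aA: "integrable M (\<lambda>x. a x * indicator A x)"
      by (rule integrable_real_mult_indicator[OF A] int_g int_a)+
    \<comment> \<open>Enlarging the denominator from \<open>R\<close> to \<open>G\<close> brings
      both laws to a common denominator.\<close>
    have "(\<integral>x. a x * indicator A x \<partial>M) / G \<le> measure (baseline_law M w \<beta>) A"
      unfolding F[OF A] using R \<open>R \<le> G\<close>
      by (intro divide_left_mono) (auto intro!: integral_nonneg_AE simp: a_def g_def)
    then have "measure (tilted_law M w) A - measure (baseline_law M w \<beta>) A
        \<le> (\<integral>x. g x * indicator A x \<partial>M) / G - (\<integral>x. a x * indicator A x \<partial>M) / G"
      by (simp add: N[OF A])
    also have "\<dots> = (\<integral>x. g x * indicator A x - a x * indicator A x \<partial>M) / G"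
      using int_gA int_aA by (simp add: diff_divide_distrib)
    \<comment> \<open>The difference \<open>g - a\<close> is nonnegative, so extending the integral
      from \<open>A\<close> to the whole space can only increase it.\<close>
    also have "\<dots> \<le> (\<integral>x. g x - a x \<partial>M) / G"
      using G int_gA int_aA int_g int_a
      by (intro divide_right_mono integral_mono) (auto simp: a_def split: split_indicator)
    finally show ?thesis .
  qed
  \<comment> \<open>Both laws have mass 1, so the one-sided bound on the complement of
    \<open>A\<close> is the bound of opposite sign on \<open>A\<close>.\<close>
  have "\<bar>measure (baseline_law M w \<beta>) A - measure (tilted_law M w) A\<bar> \<le> (\<integral>x. g x - a x \<partial>M) / G"
    if A: "A \<in> sets M" for A
    using one_sided[OF A] one_sided[of "space M - A"] A F.prob_compl[of A] N.prob_compl[of A] by auto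
  then show ?thesis
    unfolding tv_dist_def by (intro cSUP_least) (auto simp: G_def a_def g_def)
qed

text \<open>With \<open>u = w x - \<beta>\<close>, the truncation loss
  \<open>exp u - min 1 (exp u)\<close> is 0 for \<open>u \<le> 0\<close> and at most
  \<open>exp (k * u)\<close> for \<open>u > 0\<close>, as \<open>k\<close> is at least 1. The
  denominator is at least \<open>exp (\<mu> - \<beta>)\<close> by Jensen's inequality, obtained from
  the tangent line of \<open>exp\<close> at 0.\<close>

lemma (in prob_space) tv_dist_baseline_tilted_exp:
  fixes w :: "'a \<Rightarrow> real"
  assumes w [measurable]: "w \<in> borel_measurable M" and B: "\<And>x. x \<in> space M \<Longrightarrow> \<bar>w x\<bar> \<le> B"
    and k: "1 \<le> k"
  shows "tv_dist (baseline_law M w \<beta>) (tilted_law M w) \<le>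
    exp (\<beta> - (\<integral>x. w x \<partial>M)) * (\<integral>x. exp (k * (w x - \<beta>)) \<partial>M)"
proof -
  define \<mu> where "\<mu> = (\<integral>x. w x \<partial>M)"
  have int_w: "integrable M w"
    using B by (intro integrable_const_bound[of _ B]) auto
  have int_k: "integrable M (\<lambda>x. exp (k * (w x - \<beta>)))" for k
    by (rule integrable_exp_bounded[OF w B])
  have int: "integrable M (\<lambda>x. exp (w x - \<beta>))"
    using int_k[of 1] by simp
  have int_min: "integrable M (\<lambda>x. min 1 (exp (w x - \<beta>)))"
    by (rule integrable_const_bound[of _ 1]) auto
  have "(\<integral>x. exp (\<mu> - \<beta>) * (1 + (w x - \<mu>)) \<partial>M) \<le> (\<integral>x. exp (w x - \<beta>) \<partial>M)"
  proof (intro integral_mono int)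
    show "integrable M (\<lambda>x. exp (\<mu> - \<beta>) * (1 + (w x - \<mu>)))" using int_w by simp
    fix x
    have "exp (\<mu> - \<beta>) * (1 + (w x - \<mu>)) \<le> exp (\<mu> - \<beta>) * exp (w x - \<mu>)"
      by (intro mult_left_mono exp_ge_add_one_self) simp
    then show "exp (\<mu> - \<beta>) * (1 + (w x - \<mu>)) \<le> exp (w x - \<beta>)" by (simp flip: exp_add)
  qed
  then have G: "exp (\<mu> - \<beta>) \<le> (\<integral>x. exp (w x - \<beta>) \<partial>M)"
    using int_w by (simp add: \<mu>_def[symmetric] prob_space)
  have "(\<integral>x. exp (w x - \<beta>) - min 1 (exp (w x - \<beta>)) \<partial>M) \<le> (\<integral>x. exp (k * (w x - \<beta>)) \<partial>M)"
  proof (intro integral_mono int_k Bochner_Integration.integrable_diff int int_min)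
    fix x
    show "exp (w x - \<beta>) - min 1 (exp (w x - \<beta>)) \<le> exp (k * (w x - \<beta>))"
    proof (cases "w x \<le> \<beta>")
      case False
      then have "1 * (w x - \<beta>) \<le> k * (w x - \<beta>)" using k by (intro mult_right_mono) auto
      then have "exp (w x - \<beta>) \<le> exp (k * (w x - \<beta>))" by simp
      moreover have "0 \<le> min 1 (exp (w x - \<beta>))" by simp
      ultimately show ?thesis by linarith
    qed (simp add: min_def)
  qed
  then have "(\<integral>x. exp (w x - \<beta>) - min 1 (exp (w x - \<beta>)) \<partial>M) / (\<integral>x. exp (w x - \<beta>) \<partial>M)
      \<le> (\<integral>x. exp (k * (w x - \<beta>)) \<partial>M) / exp (\<mu> - \<beta>)"
    using G by (intro frac_le) auto
  also have "\<dots> = exp (\<beta> - \<mu>) * (\<integral>x. exp (k * (w x - \<beta>)) \<partial>M)"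
    by (simp add: exp_diff)
  finally show ?thesis
    using tv_dist_baseline_tilted[OF w int] by (simp add: \<mu>_def)
qed

section \<open>Measurability in the state, and the law of the sampler\<close>

lemma borel_measurable_integral_kernel:
  fixes f :: "'a \<Rightarrow> 'b \<Rightarrow> real"
  assumes K [measurable]: "K \<in> M \<rightarrow>\<^sub>M prob_algebra N"
    and f [measurable]: "(\<lambda>(x, y). f x y) \<in> borel_measurable (M \<Otimes>\<^sub>M N)"
    and nonneg: "\<And>x y. 0 \<le> f x y"
  shows "(\<lambda>x. \<integral>y. f x y \<partial>K x) \<in> borel_measurable M"
proof -
  have "(\<lambda>x. \<integral>\<^sup>+y. ennreal (f x y) \<partial>K x) \<in> borel_measurable M"
    by (rule nn_integral_measurable_subprob_algebra2[OF _ measurable_prob_algebraD[OF K]]) measurable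
  \<comment> \<open>Nonnegativity identifies the real integral with the nonnegative one, whose
    dependence on \<open>x\<close> is measurable for a measurable kernel.\<close>
  moreover have "(\<integral>y. f x y \<partial>K x) = enn2real (\<integral>\<^sup>+y. ennreal (f x y) \<partial>K x)" if x: "x \<in> space M" for x
  proof (rule integral_eq_nn_integral)
    have "sets (K x) = sets N"
      using measurable_space[OF K x] by (simp add: space_prob_algebra)
    moreover have "f x \<in> borel_measurable N" using x by measurable
    ultimately show "f x \<in> borel_measurable (K x)" by (simp cong: measurable_cong_sets)
  qed (simp add: nonneg)
  ultimately show ?thesis
    by (subst measurable_cong[where g = "\<lambda>x. enn2real (\<integral>\<^sup>+y. ennreal (f x y) \<partial>K x)"]) auto
qed

text \<open>It suffices to test measurability on each set \<open>A\<close> of \<open>N\<close>.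
  There the mass is an explicit quotient of two kernel integrals, each measurable in the
  state.\<close>

lemma measurable_baseline_law:
  assumes K [measurable]: "K \<in> M \<rightarrow>\<^sub>M prob_algebra N"
    and w [measurable]: "w \<in> borel_measurable N" and \<beta> [measurable]: "\<beta> \<in> borel_measurable M"
  shows "(\<lambda>x. baseline_law (K x) w (\<beta> x)) \<in> M \<rightarrow>\<^sub>M prob_algebra N"
proof (rule measurable_prob_algebra_generated[where \<Omega> = "space N" and G = "sets N"])
  have K_props: "prob_space (K x)" "sets (K x) = sets N" if "x \<in> space M" for x
    using measurable_space[OF K that] by (simp_all add: space_prob_algebra)
  have w': "w \<in> borel_measurable (K x)" if "x \<in> space M" for x
    using w K_props(2)[OF that] by (simp cong: measurable_cong_sets)
  have law: "prob_space (baseline_law (K x) w (\<beta> x))" if "x \<in> space M" for x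
    by (rule prob_space.prob_space_baseline_law[OF K_props(1)[OF that] w'[OF that]])
  show "prob_space (baseline_law (K x) w (\<beta> x))" "sets (baseline_law (K x) w (\<beta> x)) = sets N"
    if "x \<in> space M" for x
    using law K_props(2) that by auto
  fix A assume A [measurable]: "A \<in> sets N"
  have "emeasure (baseline_law (K x) w (\<beta> x)) A =
      ennreal ((\<integral>y. min 1 (exp (w y - \<beta> x)) * indicator A y \<partial>K x) / (\<integral>y. min 1 (exp (w y - \<beta> x)) \<partial>K x))"
    if x: "x \<in> space M" for x
  proof -
    interpret F: prob_space "baseline_law (K x) w (\<beta> x)" by (rule law[OF x])
    show ?thesis
      unfolding F.emeasure_eq_measure
      by (subst prob_space.measure_baseline_law[OF K_props(1)[OF x] w'[OF x]])
         (use A K_props(2)[OF x] in auto)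
  qed
  moreover have "(\<lambda>x. \<integral>y. min 1 (exp (w y - \<beta> x)) * indicator A y \<partial>K x) \<in> borel_measurable M"
    by (rule borel_measurable_integral_kernel[OF K]) auto
  then have "(\<lambda>x. ennreal ((\<integral>y. min 1 (exp (w y - \<beta> x)) * indicator A y \<partial>K x) /
      (\<integral>y. min 1 (exp (w y - \<beta> x)) \<partial>K x))) \<in> borel_measurable M"
    by (intro measurable_compose[OF _ measurable_ennreal] borel_measurable_divide
          borel_measurable_integral_kernel[OF K]) auto
  ultimately show "(\<lambda>x. emeasure (baseline_law (K x) w (\<beta> x)) A) \<in> borel_measurable M"
    by (subst measurable_cong) auto
qed (auto simp: sets.Int_stable sets.sigma_sets_eq sets.space_closed)

text \<open>The step from time \<open>T - n\<close> to time \<open>T - Suc n\<close> uses the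
  baseline with index \<open>T - n\<close>. Hence after \<open>n\<close> steps only indices above
  \<open>T - n\<close> have been used, and measurability is assumed for exactly those.\<close>

lemma sampler_after_prob_algebra:
  assumes init: "pT \<in> space (prob_algebra S)"
    and kernel: "\<And>s. s < T \<Longrightarrow> p s \<in> S \<rightarrow>\<^sub>M prob_algebra S"
    and v: "\<And>s. s \<le> T \<Longrightarrow> v s \<in> borel_measurable S"
    and baselines: "\<And>s. T - n < s \<Longrightarrow> s \<le> T \<Longrightarrow> Bs s \<in> borel_measurable S"
    and n: "n \<le> T"
  shows "sampler_after T pT p v Binit Bs n \<in> space (prob_algebra S)"
  using n baselines
proof (induction n)
  case 0
  interpret prob_space pT using init by (simp add: space_prob_algebra)
  have "v T \<in> borel_measurable pT"
    using init v[of T] by (simp add: space_prob_algebra cong: measurable_cong_sets)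
  from prob_space_baseline_law[OF this] show ?case
    using init by (simp add: space_prob_algebra)
next
  case (Suc n)
  have "(\<lambda>x. baseline_law (p (T - Suc n) x) (v (T - Suc n)) (Bs (T - n) x)) \<in> S \<rightarrow>\<^sub>M prob_algebra S"
    using Suc.prems(1) by (intro measurable_baseline_law kernel v Suc.prems(2)) auto
  moreover have "sampler_after T pT p v Binit Bs n \<in> space (prob_algebra S)"
    using Suc.prems(1) by (intro Suc.IH Suc.prems(2)) auto
  ultimately show ?case
    by (auto simp: space_prob_algebra intro!: prob_space_bind' sets_bind')
qed

section \<open>Expectation under the joint law as an iterated integral\<close>

lemma integral_joint_law:
  fixes f :: "'a \<times> 'a \<Rightarrow> real"
  assumes q: "q \<in> space (prob_algebra S)" and K [measurable]: "K \<in> S \<rightarrow>\<^sub>M prob_algebra S"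
    and f [measurable]: "f \<in> borel_measurable (S \<Otimes>\<^sub>M S)"
    and bdd: "\<And>z. z \<in> space (S \<Otimes>\<^sub>M S) \<Longrightarrow> \<bar>f z\<bar> \<le> C"
  shows "(\<integral>z. f z \<partial>joint_law S q K) = (\<integral>x. \<integral>y. f (x, y) \<partial>K x \<partial>q)"
proof -
  have q_props: "prob_space q" "sets q = sets S" using q by (simp_all add: space_prob_algebra)
  have K_props: "prob_space (K x)" "sets (K x) = sets S" if "x \<in> space S" for x
    using measurable_space[OF K that] by (simp_all add: space_prob_algebra)
  have space_q: "space q = space S" by (rule sets_eq_imp_space_eq[OF q_props(2)])
  define L where "L x = K x \<bind> (\<lambda>y. return (S \<Otimes>\<^sub>M S) (x, y))" for x
  have L [measurable]: "L \<in> S \<rightarrow>\<^sub>M prob_algebra (S \<Otimes>\<^sub>M S)"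
    unfolding L_def by measurable
  have Lq: "L \<in> q \<rightarrow>\<^sub>M subprob_algebra (S \<Otimes>\<^sub>M S)"
    using measurable_prob_algebraD[OF L] q_props(2) by (simp cong: measurable_cong_sets)
  have L_prob: "prob_space (L x)" if "x \<in> space S" for x
    using measurable_space[OF L that] by (simp add: space_prob_algebra)
  have fin: "finite_measure q" using q_props(1) by (simp add: prob_space_def)
  \<comment> \<open>Integral and bind may be exchanged because \<open>f\<close> is bounded and every
    kernel value has total mass 1, the constant \<open>B' = 1\<close>. The inner bind is treated in
    the same way.\<close>
  have "(\<integral>z. f z \<partial>joint_law S q K) = (\<integral>x. \<integral>z. f z \<partial>L x \<partial>q)"
    unfolding joint_law_def L_def[symmetric]
    by (rule integral_bind[OF f bdd Lq fin, where B' = 1])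
       (use L_prob space_q in \<open>auto simp: prob_space.emeasure_space_1\<close>)
  also have "\<dots> = (\<integral>x. \<integral>y. f (x, y) \<partial>K x \<partial>q)"
  proof (rule Bochner_Integration.integral_cong[OF refl])
    fix x assume "x \<in> space q"
    then have x [simp]: "x \<in> space S" by (simp add: space_q)
    have space_K: "space (K x) = space S" by (rule sets_eq_imp_space_eq[OF K_props(2)[OF x]])
    have ret: "(\<lambda>y. return (S \<Otimes>\<^sub>M S) (x, y)) \<in> K x \<rightarrow>\<^sub>M subprob_algebra (S \<Otimes>\<^sub>M S)"
      using K_props(2)[OF x] by (simp cong: measurable_cong_sets)
    have "(\<integral>z. f z \<partial>L x) = (\<integral>y. \<integral>z. f z \<partial>return (S \<Otimes>\<^sub>M S) (x, y) \<partial>K x)"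
      unfolding L_def
      by (rule integral_bind[OF f bdd ret, where B' = 1])
         (use K_props(1)[OF x] in \<open>auto simp: prob_space_def space_K space_pair_measure
            intro!: AE_I2 prob_space.emeasure_space_1[OF prob_space_return, THEN eq_refl]\<close>)
    also have "\<dots> = (\<integral>y. f (x, y) \<partial>K x)"
      by (rule Bochner_Integration.integral_cong[OF refl])
         (auto simp: space_K space_pair_measure intro!: integral_return)
    finally show "(\<integral>z. f z \<partial>L x) = (\<integral>y. f (x, y) \<partial>K x)" .
  qed
  finally show ?thesis .
qed

theorem corollary4p7:
  fixes S :: "'a measure" and T t m :: nat
    and pT :: "'a measure" and p :: "nat \<Rightarrow> 'a \<Rightarrow> 'a measure"
    and v Bs :: "nat \<Rightarrow> 'a \<Rightarrow> real"
    and B Binit \<delta> \<Lambda> \<eta> c \<sigma> Jstar :: real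
    and H :: "('a \<Rightarrow> real) set"
    and P :: "'w measure" and Z :: "nat \<Rightarrow> 'w \<Rightarrow> 'a \<times> 'a"
    and lhat :: "'w \<Rightarrow> real" and bhat :: "'w \<Rightarrow> 'a \<Rightarrow> real"
  defines "q \<equiv> sampler_marginal T pT p v Binit Bs (Suc t)"
  defines "D \<equiv> joint_law S q (p t)"
  defines "J \<equiv> J_fun (\<lambda>f. \<integral>z. f z \<partial>D) (v t) \<delta>"
    and "\<tau> \<equiv> tau_fun (\<lambda>f. \<integral>z. f z \<partial>D) (v t) \<delta>"
    and "Jhat \<equiv> \<lambda>\<omega>. J_fun (empirical_mean m (\<lambda>i. Z i \<omega>)) (v t) \<delta>"
    and "\<tau>hat \<equiv> \<lambda>\<omega>. tau_fun (empirical_mean m (\<lambda>i. Z i \<omega>)) (v t) \<delta>"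
    and "\<epsilon> \<equiv> \<lambda>\<omega>. eps0 B \<Lambda> \<eta> m H (\<lambda>i. fst (Z i \<omega>))"
  defines "Bhat \<equiv> \<lambda>\<omega> x. bhat \<omega> x + \<tau>hat \<omega> (lhat \<omega>) (bhat \<omega>) + \<epsilon> \<omega>"
    and "good \<equiv> {\<omega> \<in> space P. J (lhat \<omega>) (bhat \<omega>) - Jstar \<le> 2 * \<epsilon> \<omega> \<and>
           \<bar>\<tau>hat \<omega> (lhat \<omega>) (bhat \<omega>) - \<tau> (lhat \<omega>) (bhat \<omega>)\<bar> \<le> \<epsilon> \<omega>}"
  assumes t: "t < T" and \<delta>: "0 < \<delta>" "\<delta> < 1" and \<Lambda>: "2 < \<Lambda>"
    and \<eta>: "0 < \<eta>" "\<eta> < 1" and m: "0 < m"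
    and init: "pT \<in> space (prob_algebra S)"
    and kernel: "\<And>s. s < T \<Longrightarrow> p s \<in> S \<rightarrow>\<^sub>M prob_algebra S"
    and v_meas: "\<And>s. s \<le> T \<Longrightarrow> v s \<in> borel_measurable S"
    and v_bdd: "\<And>s x. s \<le> T \<Longrightarrow> x \<in> space S \<Longrightarrow> v s x \<in> {-B..B}"
    and baselines: "\<And>s. Suc t < s \<Longrightarrow> s \<le> T \<Longrightarrow> Bs s \<in> borel_measurable S"
    and H_meas: "H \<subseteq> borel_measurable S"
    and H_bdd: "\<And>b x. b \<in> H \<Longrightarrow> x \<in> space S \<Longrightarrow> b x \<in> {-B..B}"
    and Jstar_attained: "\<exists>l\<in>{2<..<\<Lambda>}. \<exists>b\<in>H. J l b = Jstar"
    and Jstar_least: "\<And>l b. l \<in> {2<..<\<Lambda>} \<Longrightarrow> b \<in> H \<Longrightarrow> Jstar \<le> J l b"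
    and P: "prob_space P"
    and samples_indep: "prob_space.indep_vars P (\<lambda>_. S \<Otimes>\<^sub>M S) Z {..<m}"
    and samples_law: "\<And>i. i < m \<Longrightarrow> distr P (S \<Otimes>\<^sub>M S) (Z i) = D"
    and \<sigma>: "0 < \<sigma>"
    and subgauss: "\<And>x. x \<in> space S \<Longrightarrow> sub_gaussian (p t x) (v t) (\<sigma>\<^sup>2)"
    and \<delta>_small: "\<delta> \<le> exp (- 4 * \<sigma>\<^sup>2)"
    and \<Lambda>_large: "sqrt (ln (1 / \<delta>) / \<sigma>\<^sup>2) \<le> \<Lambda>"
    and mean_in_H: "\<exists>b\<in>H. \<forall>x\<in>space S. b x = (\<integral>y. v t y \<partial>p t x)"
    and c: "0 < c" "c < 1"
    and good: "\<omega> \<in> good"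
    and argmin: "is_arg_min (\<lambda>(l, b). Jhat \<omega> l b) (\<lambda>(l, b). l \<in> {2<..<\<Lambda>} \<and> b \<in> H)
                   (lhat \<omega>, bhat \<omega>)"
    and coverage: "\<And>x. x \<in> space S \<Longrightarrow>
                     measure (p t x) {y \<in> space S. v t y \<ge> Bhat \<omega> x} \<le> c"
  shows "(\<integral>x. tv_dist (baseline_law (p t x) (v t) (Bhat \<omega> x)) (tilted_law (p t x) (v t)) \<partial>q)
           \<le> 2 * \<delta> / (1 - c)\<^sup>2 * exp (2 * \<sigma> * sqrt (ln (1 / \<delta>)) + 2 * \<epsilon> \<omega>)"
proof -
  define lam b where "lam = lhat \<omega>" and "b = bhat \<omega>"
  define L where "L = sqrt (ln (1 / \<delta>))"
  define \<mu> where "\<mu> x = (\<integral>y. v t y \<partial>p t x)" for x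
  define \<beta> where "\<beta> = Bhat \<omega>"
  \<comment> \<open>This is the population threshold at the trained pair; the baseline contains its
    empirical counterpart.\<close>
  define \<tau>' where "\<tau>' = \<tau> lam b"
  define tv where "tv x = tv_dist (baseline_law (p t x) (v t) (\<beta> x)) (tilted_law (p t x) (v t))" for x
  define f where "f = (\<lambda>(x, y). exp (lam * (v t y - b x)))"
  \<comment> \<open>\<open>\<Delta> x\<close> is the conditional mean of
    \<open>exp (lam * (v t y - b x - \<tau>'))\<close>. Its mean under \<open>q\<close> turns out to
    be \<open>\<delta>\<close>.\<close>
  define \<Delta> where "\<Delta> x = exp (- lam * \<tau>') * (\<integral>y. f (x, y) \<partial>p t x)" for x

  \<comment> \<open>Measurability and boundedness of the data\<close>
  have q: "q \<in> space (prob_algebra S)"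
    unfolding q_def sampler_marginal_def using t
    by (intro sampler_after_prob_algebra init kernel v_meas baselines) auto
  then have q_prob: "prob_space q" and sets_q [measurable_cong]: "sets q = sets S"
    by (simp_all add: space_prob_algebra)
  interpret q: prob_space q by fact
  have space_q: "space q = space S" by (rule sets_eq_imp_space_eq[OF sets_q])
  have K [measurable]: "p t \<in> S \<rightarrow>\<^sub>M prob_algebra S" using kernel t by simp
  have K_prob: "prob_space (p t x)" and sets_K: "sets (p t x) = sets S" if "x \<in> space S" for x
    using measurable_space[OF K that] by (simp_all add: space_prob_algebra)
  have space_K: "space (p t x) = space S" if "x \<in> space S" for x
    by (rule sets_eq_imp_space_eq[OF sets_K[OF that]])
  have vt [measurable]: "v t \<in> borel_measurable S" using v_meas t by simp
  have vK: "v t \<in> borel_measurable (p t x)" if "x \<in> space S" for x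
    using vt sets_K[OF that] by (simp cong: measurable_cong_sets)
  have vB: "\<bar>v t y\<bar> \<le> B" if "y \<in> space S" for y
    using v_bdd[of t y] that t by auto
  have lam: "2 < lam" and b: "b \<in> H"
    using argmin by (auto simp: is_arg_min_def lam_def b_def)
  have b_meas [measurable]: "b \<in> borel_measurable S" using b H_meas by auto
  have bB: "\<bar>b x\<bar> \<le> B" if "x \<in> space S" for x using H_bdd[OF b that] by auto

  \<comment> \<open>Constants and consequences of the good event\<close>
  have "0 < ln (1 / \<delta>)" using \<delta> by simp
  then have L: "0 < L" and L2: "L\<^sup>2 = ln (1 / \<delta>)" by (simp_all add: L_def)
  have \<delta>_eq: "\<delta> = exp (- L\<^sup>2)" using \<delta> by (simp add: L2 ln_div)
  \<comment> \<open>On the logarithmic scale the smallness of \<open>\<delta>\<close> says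
    \<open>4 * \<sigma>\<^sup>2 \<le> L\<^sup>2\<close>; square roots then give
    \<open>2 * \<sigma> \<le> L\<close>.\<close>
  have "(2 * \<sigma>)\<^sup>2 \<le> L\<^sup>2" using \<delta>_small by (simp add: \<delta>_eq power2_eq_square)
  then have L\<sigma>: "2 * \<sigma> \<le> L" by (rule power2_le_imp_le) (use L in simp)
  \<comment> \<open>The bound on the absolute value in the second condition of \<open>good\<close>
    yields both facts: \<open>\<epsilon> \<omega>\<close> dominates a nonnegative number, and adding
    it to the empirical threshold reaches at least the population threshold.\<close>
  have \<epsilon>: "0 \<le> \<epsilon> \<omega>" and \<tau>'_le: "\<tau>' \<le> \<tau>hat \<omega> lam b + \<epsilon> \<omega>"
    using good abs_ge_zero[of "\<tau>hat \<omega> lam b - \<tau>'"]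
    unfolding good_def lam_def[symmetric] b_def[symmetric] \<tau>'_def[symmetric] mem_Collect_eq
    by linarith+
  have \<beta>_ge: "b x + \<tau>' \<le> \<beta> x" for x
    using \<tau>'_le by (simp add: \<beta>_def Bhat_def lam_def b_def)

  \<comment> \<open>The mean of \<open>\<Delta>\<close> under the sampler\<close>
  have f_meas [measurable]: "f \<in> borel_measurable (S \<Otimes>\<^sub>M S)" unfolding f_def by measurable
  have f_bdd: "\<bar>f z\<bar> \<le> exp (lam * (2 * B))" if "z \<in> space (S \<Otimes>\<^sub>M S)" for z
    using that lam vB[of "snd z"] bB[of "fst z"]
    by (auto simp: f_def space_pair_measure intro!: mult_left_mono)
  have Df: "(\<integral>z. f z \<partial>D) = (\<integral>x. \<integral>y. f (x, y) \<partial>p t x \<partial>q)"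
    unfolding D_def by (rule integral_joint_law[OF q K f_meas f_bdd])
  have \<Delta>_meas: "(\<lambda>x. \<integral>y. f (x, y) \<partial>p t x) \<in> borel_measurable S"
    by (rule borel_measurable_integral_kernel[OF K]) (auto simp: f_def)
  have int_f: "integrable (p t x) (\<lambda>y. f (x, y))" if "x \<in> space S" for x
    using prob_space.integrable_exp_bounded[OF K_prob[OF that] vK[OF that], of B lam "b x"] vB
    by (simp add: f_def space_K[OF that])
  have If_pos: "0 < (\<integral>y. f (x, y) \<partial>p t x)" if "x \<in> space S" for x
    using prob_space.integral_exp_pos[OF K_prob[OF that], of "\<lambda>y. lam * (v t y - b x)"] int_f[OF that]
    by (simp add: f_def)
  have If_bdd: "(\<integral>y. f (x, y) \<partial>p t x) \<le> exp (lam * (2 * B))" if x: "x \<in> space S" for x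
  proof -
    interpret Kx: prob_space "p t x" by (rule K_prob[OF x])
    show ?thesis
      using f_bdd[of "(x, _)"] x space_K[OF x]
      by (intro Kx.integral_le_const[OF int_f[OF x]] AE_I2)
         (auto simp: space_pair_measure f_def)
  qed
  have int_If: "integrable q (\<lambda>x. \<integral>y. f (x, y) \<partial>p t x)"
  proof (rule q.integrable_const_bound[of _ "exp (lam * (2 * B))"])
    show "AE x in q. norm (\<integral>y. f (x, y) \<partial>p t x) \<le> exp (lam * (2 * B))"
      using If_bdd If_pos by (intro AE_I2) (auto simp: space_q abs_of_pos)
  qed (use \<Delta>_meas in measurable)
  have int_\<Delta>: "integrable q \<Delta>" unfolding \<Delta>_def using int_If by simp
  \<comment> \<open>Strict positivity is what allows \<open>exp\<close> to undo the
    \<open>ln\<close> in the definition of \<open>\<tau>\<close>.\<close>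
  have "0 < (\<integral>z. f z \<partial>D)"
  proof -
    have "(\<integral>x. \<integral>y. f (x, y) \<partial>p t x \<partial>q) \<noteq> 0"
    proof
      assume "(\<integral>x. \<integral>y. f (x, y) \<partial>p t x \<partial>q) = 0"
      then have "AE x in q. (\<integral>y. f (x, y) \<partial>p t x) = 0"
        using int_If by (subst (asm) integral_nonneg_eq_0_iff_AE) (auto simp: f_def)
      then have "AE x in q. False"
        by (rule AE_mp) (use If_pos in \<open>force intro!: AE_I2 simp: space_q\<close>)
      then show False by simp
    qed
    moreover have "0 \<le> (\<integral>z. f z \<partial>D)"
      by (intro integral_nonneg_AE AE_I2) (simp add: f_def split_beta)
    ultimately show ?thesis using Df by linarith
  qed
  \<comment> \<open>By definition \<open>lam * \<tau>'\<close> is \<open>ln (1 / \<delta>)\<close>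
    plus the logarithm of the integral of \<open>f\<close>, so its negative exponentiates to
    \<open>\<delta>\<close> divided by that integral.\<close>
  then have "exp (- lam * \<tau>') * (\<integral>z. f z \<partial>D) = \<delta>"
    using lam \<delta> by (simp add: \<tau>'_def \<tau>_def tau_fun_def f_def[symmetric] ln_div exp_diff)
  then have \<Delta>_integral: "(\<integral>x. \<Delta> x \<partial>q) = \<delta>"
    unfolding \<Delta>_def by (simp add: Df)

  \<comment> \<open>Bound on the distance at a fixed state\<close>
  have tv_le: "tv x \<le> exp (2 * \<sigma> * L) * (\<Delta> x + \<delta>\<^sup>2)" if x: "x \<in> space S" for x
  proof -
    interpret Kx: prob_space "p t x" by (rule K_prob[OF x])
    have v_bddK: "\<bar>v t y\<bar> \<le> B" if "y \<in> space (p t x)" for y using that vB space_K[OF x] by simp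
    note tv_exp = Kx.tv_dist_baseline_tilted_exp[OF vK[OF x] v_bddK, of _ "\<beta> x",
        folded tv_def \<mu>_def]
    have \<Delta>_pos: "0 < \<Delta> x" using If_pos[OF x] by (simp add: \<Delta>_def)
    show ?thesis
    \<comment> \<open>Each case produces one of the summands \<open>\<Delta> x\<close> and
      \<open>\<delta>\<^sup>2\<close>; the other is nonnegative and is added so that a single bound
      covers both.\<close>
    proof (cases "\<beta> x - \<mu> x \<le> 2 * \<sigma> * L")
      case True
      have "(\<integral>y. exp (lam * (v t y - \<beta> x)) \<partial>p t x) \<le> (\<integral>y. exp (- lam * \<tau>') * f (x, y) \<partial>p t x)"
      proof (intro integral_mono Kx.integrable_exp_bounded[OF vK[OF x] v_bddK]
          integrable_mult_right[OF int_f[OF x]])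
        fix y
        have "lam * (v t y - \<beta> x) \<le> lam * (v t y - (b x + \<tau>'))"
          using lam \<beta>_ge[of x] by (intro mult_left_mono) auto
        then show "exp (lam * (v t y - \<beta> x)) \<le> exp (- lam * \<tau>') * f (x, y)"
          by (simp add: f_def algebra_simps flip: exp_add)
      qed
      then have "(\<integral>y. exp (lam * (v t y - \<beta> x)) \<partial>p t x) \<le> \<Delta> x" by (simp add: \<Delta>_def)
      then have "exp (\<beta> x - \<mu> x) * (\<integral>y. exp (lam * (v t y - \<beta> x)) \<partial>p t x) \<le> exp (2 * \<sigma> * L) * \<Delta> x"
        using True by (intro mult_mono) auto
      with tv_exp[of lam] lam have "tv x \<le> exp (2 * \<sigma> * L) * \<Delta> x" by linarith
      also have "\<dots> \<le> exp (2 * \<sigma> * L) * (\<Delta> x + \<delta>\<^sup>2)" by (intro mult_left_mono) auto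
      finally show ?thesis .
    next
      case False
      \<comment> \<open>The exponent \<open>k\<^sup>2 * \<sigma>\<^sup>2 / 2 - k * s\<close> of the
        Chernoff bound is minimal at \<open>k = s / \<sigma>\<^sup>2\<close>; this is its minimiser
        at the boundary value \<open>s = 2 * \<sigma> * L\<close> of the case.\<close>
      define k where "k = 2 * L / \<sigma>"
      define s where "s = \<beta> x - \<mu> x"
      have k: "4 \<le> k" using L\<sigma> \<sigma> by (simp add: k_def field_simps)
      have "(\<integral>y. exp (k * (v t y - \<beta> x)) \<partial>p t x) = exp (- k * s) * (\<integral>y. exp (k * (v t y - \<mu> x)) \<partial>p t x)"
        by (simp add: s_def algebra_simps flip: exp_add integral_mult_right_zero)
      also have "\<dots> \<le> exp (- k * s) * exp (k\<^sup>2 * \<sigma>\<^sup>2 / 2)"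
        using subgauss[OF x] by (intro mult_left_mono) (auto simp: sub_gaussian_def \<mu>_def)
      also have "k\<^sup>2 * \<sigma>\<^sup>2 / 2 = 2 * L\<^sup>2" using \<sigma> by (simp add: k_def power2_eq_square)
      finally have "exp s * (\<integral>y. exp (k * (v t y - \<beta> x)) \<partial>p t x) \<le> exp s * (exp (- k * s) * exp (2 * L\<^sup>2))"
        by (intro mult_left_mono) auto
      with tv_exp[of k] k have "tv x \<le> exp s * (exp (- k * s) * exp (2 * L\<^sup>2))"
        unfolding s_def by linarith
      also have "\<dots> = exp (2 * L\<^sup>2 - (k - 1) * s)"
        by (simp add: algebra_simps flip: exp_add)
      \<comment> \<open>The exponent decreases in \<open>s\<close> because \<open>k > 1\<close>, so
        the boundary value of \<open>s\<close> is the worst one. The growth of the prefactor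
        \<open>exp s\<close> is thereby absorbed.\<close>
      also have "\<dots> \<le> exp (2 * L\<^sup>2 - (k - 1) * (2 * \<sigma> * L))"
        using False k by (auto simp: s_def intro!: mult_left_mono)
      also have "2 * L\<^sup>2 - (k - 1) * (2 * \<sigma> * L) = 2 * \<sigma> * L - 2 * L\<^sup>2"
        using \<sigma> by (simp add: k_def field_simps power2_eq_square)
      also have "exp (2 * \<sigma> * L - 2 * L\<^sup>2) = exp (2 * \<sigma> * L) * \<delta>\<^sup>2"
        by (simp add: \<delta>_eq exp_diff exp_minus field_simps flip: exp_double)
      also have "\<dots> \<le> exp (2 * \<sigma> * L) * (\<Delta> x + \<delta>\<^sup>2)" using \<Delta>_pos by (intro mult_left_mono) auto
      finally show ?thesis .
    qed
  qed

  \<comment> \<open>Integration over the state\<close>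
  have "(\<integral>x. tv x \<partial>q) \<le> (\<integral>x. exp (2 * \<sigma> * L) * (\<Delta> x + \<delta>\<^sup>2) \<partial>q)"
  \<comment> \<open>As a supremum over all measurable sets, \<open>tv\<close> is not known to be
    measurable. If it is not integrable, its Bochner integral is 0 and the nonnegative right side
    bounds it.\<close>
  proof (cases "integrable q tv")
    case True
    then show ?thesis using int_\<Delta> tv_le by (intro integral_mono) (auto simp: space_q)
  next
    case False
    have "0 \<le> \<Delta> x" if "x \<in> space q" for x using If_pos that by (simp add: \<Delta>_def space_q less_imp_le)
    then have "0 \<le> (\<integral>x. exp (2 * \<sigma> * L) * (\<Delta> x + \<delta>\<^sup>2) \<partial>q)"
      by (intro integral_nonneg_AE AE_I2) auto
    with False show ?thesis by (simp add: not_integrable_integral_eq)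
  qed
  also have "\<dots> = (\<delta> + \<delta>\<^sup>2) * exp (2 * \<sigma> * L)"
    using int_\<Delta> by (simp add: \<Delta>_integral q.prob_space)
  \<comment> \<open>Here \<open>\<delta> < 1\<close> gives
    \<open>\<delta>\<^sup>2 \<le> \<delta>\<close>, and the factors
    \<open>1 / (1 - c)\<^sup>2\<close> and \<open>exp (2 * \<epsilon> \<omega>)\<close> are at least
    1.\<close>
  also have "\<dots> \<le> 2 * \<delta> / (1 - c)\<^sup>2 * exp (2 * \<sigma> * L + 2 * \<epsilon> \<omega>)"
  proof (intro mult_mono)
    have "\<delta> + \<delta>\<^sup>2 \<le> 2 * \<delta>" using \<delta> by (simp add: power2_eq_square)
    also have "\<dots> \<le> 2 * \<delta> / (1 - c)\<^sup>2"
    proof -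
      have "(1 - c)\<^sup>2 \<le> 1" "0 < (1 - c)\<^sup>2" using c by (auto simp: power_le_one)
      then show ?thesis using \<delta> by (simp add: pos_le_divide_eq mult_left_le)
    qed
    finally show "\<delta> + \<delta>\<^sup>2 \<le> 2 * \<delta> / (1 - c)\<^sup>2" .
  qed (use \<epsilon> \<delta> in auto)
  finally show ?thesis by (simp add: tv_def[abs_def] \<beta>_def L_def)
qed

end
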